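(* Let $I \subset S=\mathbb{K}[x_1,x_2]$ be a monomial ideal with the minimal set of generators $\mathcal{G}(I)=\{x_1^{a_i}x_2^{b_i}\}_{i=1,\ldots,m}$. Assume that $a_1> a_2 > \cdots > a_m \geq 0$ and $0 \leq b_1 < b_2 < \cdots < b_m$. Then $$\mathrm{sat}(I)=s-a_m-b_1-1,$$ where $s=\max \{a_i+b_{i+1} : i=1, \ldots , m-1\}$.
   Context: $\mathbb{K}$ is a field, $S=\mathbb{K}[x_1,x_2]$ and $\mathfrak{m}=(x_1,x_2)$. For ideals $I,J$ of $S$, $I\colon J=\{f\in S : fJ\subseteq I\}$, and $\mathfrak{m}^0=S$. The saturation number of an ideal $I\subset S$ is $\mathrm{sat}(I)=\min\{k\geq 0 : I\colon\mathfrak{m}^k=I\colon\mathfrak{m}^{k+1}\}$. $\mathcal{G}(I)$ denotes the unique set of minimal monomial generators of a monomial ideal $I$. *)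

theory Defs
  imports Complex_Main "HOL-Library.Poly_Mapping" "HOL-Library.Product_Plus"
begin

text \<open>
  The polynomial ring in two variables over \<open>'k\<close> is the monoid algebra of \<open>nat \<times> nat\<close>: an
  exponent pair \<open>(i, j)\<close> is mapped to the coefficient of the monomial with these exponents.
\<close>

type_synonym 'k bipoly = "(nat \<times> nat) \<Rightarrow>\<^sub>0 'k"

definition x1 :: "'k::field bipoly"
  where "x1 = Poly_Mapping.single (1, 0) 1"

definition x2 :: "'k::field bipoly"
  where "x2 = Poly_Mapping.single (0, 1) 1"

text \<open>
  Ideals of a commutative ring are the submodules of the ring as a module over itself; the ideal
  generated by a set is its span.
\<close>

interpretation ideal: module "(*) :: 'a::comm_ring_1 \<Rightarrow> 'a \<Rightarrow> 'a"
  by standard (simp_all add: algebra_simps)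

abbreviation ideal_gen :: "'a::comm_ring_1 set \<Rightarrow> 'a set"
  where "ideal_gen \<equiv> ideal.span"

definition ideal_prod :: "'a::comm_ring_1 set \<Rightarrow> 'a set \<Rightarrow> 'a set"
  where "ideal_prod I J = ideal_gen {f * g | f g. f \<in> I \<and> g \<in> J}"

primrec ideal_pow :: "'a::comm_ring_1 set \<Rightarrow> nat \<Rightarrow> 'a set"
  where
    "ideal_pow I 0 = UNIV"
  | "ideal_pow I (Suc n) = ideal_prod I (ideal_pow I n)"

definition colon :: "'a::comm_ring_1 set \<Rightarrow> 'a set \<Rightarrow> 'a set"
  where "colon I J = {f. \<forall>g\<in>J. f * g \<in> I}"

definition max_ideal :: "'k::field bipoly set"
  where "max_ideal = ideal_gen {x1, x2}"

definition sat :: "'k::field bipoly set \<Rightarrow> nat"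
  where "sat I =
    (LEAST k. colon I (ideal_pow max_ideal k) = colon I (ideal_pow max_ideal (k + 1)))"

definition monomials :: "'k::field bipoly set"
  where "monomials = {x1 ^ i * x2 ^ j | i j. True}"

definition monomial_ideal :: "'k::field bipoly set \<Rightarrow> bool"
  where "monomial_ideal I \<longleftrightarrow> (\<exists>A \<subseteq> monomials. I = ideal_gen A)"

definition minimal_monomial_gens :: "'k::field bipoly set \<Rightarrow> 'k bipoly set \<Rightarrow> bool"
  where "minimal_monomial_gens I G \<longleftrightarrow>
    G \<subseteq> monomials \<and> ideal_gen G = I \<and> (\<forall>H. H \<subset> G \<longrightarrow> ideal_gen H \<noteq> I)"

text \<open>Well-defined by \<open>ex1_minimal_monomial_gens\<close> below.\<close>

definition min_gens :: "'k::field bipoly set \<Rightarrow> 'k bipoly set"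
  where "min_gens I = (THE G. minimal_monomial_gens I G)"

lemma monomial_eq_single:
  "(x1 ^ i * x2 ^ j :: 'k::field bipoly) = Poly_Mapping.single (i, j) 1"
proof -
  have "(x1 ^ i :: 'k bipoly) = Poly_Mapping.single (i, 0) 1"
    by (induction i) (simp_all add: x1_def mult_single flip: zero_prod_def)
  moreover have "(x2 ^ j :: 'k bipoly) = Poly_Mapping.single (0, j) 1"
    by (induction j) (simp_all add: x2_def mult_single flip: zero_prod_def)
  ultimately show ?thesis
    by (simp add: mult_single)
qed

lemma monomials_eq: "monomials = range (\<lambda>e. Poly_Mapping.single e (1::'k::field))"
  by (auto simp: monomials_def monomial_eq_single)

lemma keys_ideal_gen_monomials:
  fixes f :: "'k::field bipoly"
  assumes "f \<in> ideal_gen A" "A \<subseteq> monomials" "k \<in> Poly_Mapping.keys f"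
  shows "\<exists>e d. Poly_Mapping.single e 1 \<in> A \<and> k = e + d"
  using assms(1,3)
proof (induction arbitrary: k rule: ideal.span_induct_alt)
  case base
  then show ?case by simp
next
  case (step c x y)
  obtain e where e: "x = Poly_Mapping.single e 1"
    using step.hyps(1) assms(2) unfolding monomials_eq by auto
  have "k \<in> Poly_Mapping.keys (c * x) \<or> k \<in> Poly_Mapping.keys y"
    using step.prems keys_add[of "c * x" y] by auto
  then show ?case
  proof
    assume "k \<in> Poly_Mapping.keys (c * x)"
    then obtain d where "k = d + e"
      using keys_mult[of c x] by (auto simp: e)
    then show ?case
      using step.hyps(1) e by (metis add.commute)
  qed (rule step.IH)
qed

lemma monomial_in_ideal_gen_iff:
  fixes A :: "'k::field bipoly set"
  assumes "A \<subseteq> monomials"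
  shows "Poly_Mapping.single k 1 \<in> ideal_gen A \<longleftrightarrow>
    (\<exists>e d. Poly_Mapping.single e 1 \<in> A \<and> k = e + d)"
proof
  assume "Poly_Mapping.single k 1 \<in> ideal_gen A"
  then show "\<exists>e d. Poly_Mapping.single e 1 \<in> A \<and> k = e + d"
    using keys_ideal_gen_monomials[OF _ assms] by simp
next
  assume "\<exists>e d. Poly_Mapping.single e 1 \<in> A \<and> k = e + d"
  then obtain e d where e: "Poly_Mapping.single e 1 \<in> A" "k = e + d" by blast
  have "(Poly_Mapping.single k 1 :: 'k bipoly) =
      Poly_Mapping.single d 1 * Poly_Mapping.single e 1"
    by (simp add: mult_single e(2) add.commute)
  then show "Poly_Mapping.single k 1 \<in> ideal_gen A"
    using e(1) by (simp add: ideal.span_scale ideal.span_base)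
qed

lemma minimal_monomial_gens_dvd:
  assumes "minimal_monomial_gens I G"
    and "Poly_Mapping.single e 1 \<in> G" "Poly_Mapping.single (e + d) 1 \<in> G"
  shows "d = 0"
proof (rule ccontr)
  assume "d \<noteq> 0"
  let ?u = "Poly_Mapping.single (e + d) 1" and ?H = "G - {Poly_Mapping.single (e + d) 1}"
  have G: "G \<subseteq> monomials" "ideal_gen G = I" "ideal_gen ?H \<noteq> I"
    using assms by (auto simp: minimal_monomial_gens_def)
  have "e \<noteq> e + d" using \<open>d \<noteq> 0\<close> by (metis add.right_neutral add_left_cancel)
  then have "Poly_Mapping.single e 1 \<in> ?H"
    using assms(2) by (auto dest: arg_cong[where f = Poly_Mapping.keys])
  then have "?u \<in> ideal_gen ?H"
    using monomial_in_ideal_gen_iff[of ?H "e + d"] G(1) by blast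
  then have "G \<subseteq> ideal_gen ?H"
    using ideal.span_base[of _ ?H] by blast
  then have "ideal_gen G \<subseteq> ideal_gen ?H"
    by (simp add: ideal.span_minimal)
  moreover have "ideal_gen ?H \<subseteq> ideal_gen G"
    by (rule ideal.span_mono) blast
  ultimately show False using G by blast
qed

lemma minimal_monomial_gens_subset:
  assumes G: "minimal_monomial_gens I G" and H: "minimal_monomial_gens I H"
  shows "G \<subseteq> H"
proof
  fix u assume u: "u \<in> G"
  have sub: "G \<subseteq> monomials" "H \<subseteq> monomials" "ideal_gen G = I" "ideal_gen H = I"
    using G H by (auto simp: minimal_monomial_gens_def)
  obtain k where k: "u = Poly_Mapping.single k 1"
    using u sub(1) unfolding monomials_eq by auto
  have "Poly_Mapping.single k 1 \<in> ideal_gen H"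
    using u k sub ideal.span_base by metis
  then obtain e d where e: "Poly_Mapping.single e 1 \<in> H" "k = e + d"
    using monomial_in_ideal_gen_iff[OF sub(2)] by blast
  have "Poly_Mapping.single e 1 \<in> ideal_gen G"
    using e sub ideal.span_base by metis
  then obtain e' d' where e': "Poly_Mapping.single e' 1 \<in> G" "e = e' + d'"
    using monomial_in_ideal_gen_iff[OF sub(1)] by blast
  have "d' + d = 0"
    using minimal_monomial_gens_dvd[OF G e'(1), of "d' + d"] u k e e' by (simp add: add.assoc)
  then have "d = 0"
    by (auto simp: prod_eq_iff)
  then show "u \<in> H" using e k by simp
qed

lemma ex1_minimal_monomial_gens:
  fixes I :: "'k::field bipoly set"
  assumes "monomial_ideal I"
  shows "\<exists>!G. minimal_monomial_gens I G"
proof -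
  obtain A where A: "A \<subseteq> monomials" "I = ideal_gen A"
    using assms unfolding monomial_ideal_def by blast
  define E where "E = {e. (Poly_Mapping.single e 1 :: 'k bipoly) \<in> A}"
  define M where "M = {e \<in> E. \<forall>e'\<in>E. \<forall>d. e = e' + d \<longrightarrow> d = 0}"
  define G where "G = (\<lambda>e. Poly_Mapping.single e (1::'k)) ` M"
  have Gm: "G \<subseteq> monomials" by (auto simp: G_def monomials_eq)
  have inG: "Poly_Mapping.single e 1 \<in> G \<longleftrightarrow> e \<in> M" for e
    by (auto simp: G_def dest: arg_cong[where f = Poly_Mapping.keys])
  have below: "\<exists>e'\<in>M. \<exists>d. e = e' + d" if "e \<in> E" for e
    using that
  proof (induction "fst e + snd e" arbitrary: e rule: less_induct)
    case less
    show ?case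
    proof (cases "e \<in> M")
      case True
      then show ?thesis by (metis add.right_neutral)
    next
      case False
      then obtain e' d where e': "e' \<in> E" "e = e' + d" "d \<noteq> 0"
        using less.prems by (auto simp: M_def)
      have "fst e' + snd e' < fst e + snd e"
        using e'(2,3) by (cases d) (auto simp: zero_prod_def)
      from less.hyps[OF this e'(1)] obtain e'' d' where "e'' \<in> M" "e' = e'' + d'" by blast
      then show ?thesis using e'(2) by (metis add.assoc)
    qed
  qed
  have "A \<subseteq> ideal_gen G"
  proof
    fix u assume "u \<in> A"
    then obtain e where e: "u = Poly_Mapping.single e 1" "e \<in> E"
      using A(1) unfolding monomials_eq E_def by auto
    show "u \<in> ideal_gen G"
      unfolding e(1) monomial_in_ideal_gen_iff[OF Gm] inG using below[OF e(2)] by blast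
  qed
  then have "I \<subseteq> ideal_gen G"
    unfolding A(2) by (simp add: ideal.span_minimal)
  moreover have "ideal_gen G \<subseteq> I"
    unfolding A(2) by (rule ideal.span_mono) (auto simp: G_def M_def E_def)
  ultimately have gen: "ideal_gen G = I" by blast
  have "ideal_gen H \<noteq> I" if H: "H \<subset> G" for H
  proof
    assume eq: "ideal_gen H = I"
    obtain e where e: "e \<in> M" "Poly_Mapping.single e 1 \<notin> H" using H by (auto simp: G_def)
    have "Poly_Mapping.single e 1 \<in> ideal_gen H"
      using eq gen inG e(1) ideal.span_base by metis
    moreover have "H \<subseteq> monomials" using H Gm by blast
    ultimately obtain e' d where e': "Poly_Mapping.single e' 1 \<in> H" "e = e' + d"
      using monomial_in_ideal_gen_iff by blast
    then have "e' \<in> E" using H inG unfolding M_def by blast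
    then have "d = 0" using e(1) e'(2) unfolding M_def by blast
    then show False using e(2) e' by simp
  qed
  then have "minimal_monomial_gens I G"
    using Gm gen by (simp add: minimal_monomial_gens_def)
  then show ?thesis
    using minimal_monomial_gens_subset by blast
qed

end

theory Submission
  imports Defs
begin

text \<open>
  A monomial ideal \<open>I\<close> is determined by the up-set \<open>U\<close> of its exponents, and a polynomial lies in
  \<open>I : \<mm>\<^sup>k\<close> iff for each of its exponents \<open>e\<close> all exponents of degree \<open>deg e + k\<close> above \<open>e\<close> are in
  \<open>U\<close>. Hence all elements of any \<open>I : \<mm>\<^sup>k\<close> are divisible by \<open>x\<^sub>1\<^bsup>a\<^sub>m\<^esup> x\<^sub>2\<^bsup>b\<^sub>1\<^esup>\<close>. Among the multiples of
  this monomial, those outside \<open>I\<close> of maximal degree are corners \<open>(a\<^sub>i - 1, b\<^sub>i\<^sub>+\<^sub>1 - 1)\<close> of the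
  staircase, of degree \<open>s - 2\<close>. So \<open>I : \<mm>\<^sup>k\<close> is stationary from \<open>k = s - 1 - a\<^sub>m - b\<^sub>1\<close> on, and for
  smaller \<open>k\<close> a divisor of degree \<open>s - 2 - k\<close> of such a corner separates \<open>I : \<mm>\<^sup>k\<close> from
  \<open>I : \<mm>\<^sup>k\<^sup>+\<^sup>1\<close>.
\<close>

abbreviation total_deg :: "nat \<times> nat \<Rightarrow> nat"
  where "total_deg e \<equiv> fst e + snd e"

lemma poly_mapping_sum_single:
  "(\<Sum>k\<in>Poly_Mapping.keys f. Poly_Mapping.single k (Poly_Mapping.lookup f k)) = f"
  by (rule poly_mapping_eqI)
    (auto simp: lookup_sum lookup_single when_def not_in_keys_iff_lookup_eq_zero)

lemma single_one_eq_iff [simp]: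
  "Poly_Mapping.single e (1::'k::zero_neq_one) = Poly_Mapping.single e' 1 \<longleftrightarrow> e = e'"
  by (auto dest: arg_cong[where f = Poly_Mapping.keys])

text \<open>Cancellation makes \<open>\<lambda>j. j + e\<close> injective, so distinct terms of
  \<open>f\<close> stay distinct after multiplication and only the term at \<open>k\<close>
  contributes at \<open>k + e\<close>.\<close>

lemma lookup_mult_single_shift:
  fixes f :: "'a::cancel_comm_monoid_add \<Rightarrow>\<^sub>0 'k::semiring_0"
  shows "Poly_Mapping.lookup (f * Poly_Mapping.single e c) (k + e) = Poly_Mapping.lookup f k * c"
proof -
  have "f * Poly_Mapping.single e c =
      (\<Sum>j\<in>Poly_Mapping.keys f. Poly_Mapping.single (j + e) (Poly_Mapping.lookup f j * c))"
    by (subst (1) poly_mapping_sum_single[of f, symmetric]) (simp add: sum_distrib_right mult_single)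
  then show ?thesis
    by (auto simp: lookup_sum lookup_single when_def not_in_keys_iff_lookup_eq_zero)
qed

lemma subspace_mem_if_monomials_mem:
  fixes f :: "'k::field bipoly"
  assumes "ideal.subspace J" "\<And>k. k \<in> Poly_Mapping.keys f \<Longrightarrow> Poly_Mapping.single k 1 \<in> J"
  shows "f \<in> J"
proof -
  have "Poly_Mapping.single k (Poly_Mapping.lookup f k) \<in> J" if "k \<in> Poly_Mapping.keys f" for k
    using ideal.subspace_scale[OF assms(1) assms(2)[OF that],
        of "Poly_Mapping.single 0 (Poly_Mapping.lookup f k)"]
    by (simp add: mult_single)
  then have "(\<Sum>k\<in>Poly_Mapping.keys f. Poly_Mapping.single k (Poly_Mapping.lookup f k)) \<in> J"
    by (rule ideal.subspace_sum[OF assms(1)])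
  then show ?thesis
    by (simp only: poly_mapping_sum_single)
qed

text \<open>Reduces membership in a monomial ideal to exponents: every exponent of an element lies
  above one from \<open>A\<close>, and conversely \<open>f\<close> is the sum of its terms.\<close>

lemma mem_ideal_gen_monomials_iff:
  fixes A :: "'k::field bipoly set"
  assumes "A \<subseteq> monomials"
  shows "f \<in> ideal_gen A \<longleftrightarrow>
    (\<forall>k\<in>Poly_Mapping.keys f. Poly_Mapping.single k 1 \<in> ideal_gen A)"
proof
  show "\<forall>k\<in>Poly_Mapping.keys f. Poly_Mapping.single k 1 \<in> ideal_gen A" if "f \<in> ideal_gen A"
    unfolding monomial_in_ideal_gen_iff[OF assms]
    using keys_ideal_gen_monomials[OF that assms] by blast
qed (rule subspace_mem_if_monomials_mem[OF ideal.subspace_span], blast)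

lemma subspace_ideal_pow: "ideal.subspace (ideal_pow I n)"
  by (cases n) (auto simp: ideal_prod_def)

lemma mem_max_ideal_iff:
  "f \<in> max_ideal \<longleftrightarrow> (\<forall>k\<in>Poly_Mapping.keys f. 1 \<le> total_deg k)"
proof -
  have sub: "{x1, x2 :: 'a bipoly} \<subseteq> monomials"
    by (auto simp: monomials_eq x1_def x2_def)
  have "(Poly_Mapping.single k 1 :: 'a bipoly) \<in> {x1, x2} \<longleftrightarrow> k = (1, 0) \<or> k = (0, 1)" for k
    unfolding x1_def x2_def by simp
  moreover have "(\<exists>e d. (e = (1, 0) \<or> e = (0, 1)) \<and> k = e + d) \<longleftrightarrow> 1 \<le> total_deg k"
    for k :: "nat \<times> nat"
  proof
    assume "1 \<le> total_deg k"
    then have "k = (1, 0) + (k - (1, 0)) \<or> k = (0, 1) + (k - (0, 1))"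
      by (auto simp: prod_eq_iff)
    then show "\<exists>e d. (e = (1, 0) \<or> e = (0, 1)) \<and> k = e + d"
      by blast
  qed auto
  ultimately show ?thesis
    unfolding max_ideal_def mem_ideal_gen_monomials_iff[OF sub, of f] monomial_in_ideal_gen_iff[OF sub]
    by simp
qed

lemma total_deg_split:
  fixes k :: "nat \<times> nat"
  assumes "n \<le> total_deg k"
  obtains d e where "k = d + e" "total_deg d = n"
proof
  \<comment> \<open>Greedy choice: as much as possible of the degree \<open>n\<close> is taken from
    the first coordinate, the rest from the second.\<close>
  show "k = (min n (fst k), n - min n (fst k)) + (k - (min n (fst k), n - min n (fst k)))"
    using assms by (auto simp: prod_eq_iff)
qed (use assms in auto)

text \<open>Induction on \<open>n\<close>. Degrees add in products, and a coefficient
  \<open>c\<close> can only raise them; conversely, a monomial of degree at least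
  \<open>n + 1\<close> splits off one variable.\<close>

lemma mem_max_ideal_pow_iff:
  "f \<in> ideal_pow max_ideal n \<longleftrightarrow> (\<forall>k\<in>Poly_Mapping.keys f. n \<le> total_deg k)"
proof
  assume "f \<in> ideal_pow max_ideal n"
  then show "\<forall>k\<in>Poly_Mapping.keys f. n \<le> total_deg k"
  proof (induction n arbitrary: f)
    case (Suc n)
    from Suc.prems have "f \<in> ideal_gen {u * v | u v. u \<in> max_ideal \<and> v \<in> ideal_pow max_ideal n}"
      by (simp add: ideal_prod_def)
    then show ?case
    proof (induction rule: ideal.span_induct_alt)
      case (step c x y)
      then obtain u v where x: "x = u * v" "u \<in> max_ideal" "v \<in> ideal_pow max_ideal n"
        by blast
      have "Suc n \<le> total_deg k" if k: "k \<in> Poly_Mapping.keys (c * x)" for k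
      proof -
        obtain p q where p: "p \<in> Poly_Mapping.keys c" "q \<in> Poly_Mapping.keys x" "k = p + q"
          using k keys_mult[of c x] by blast
        obtain r t where "r \<in> Poly_Mapping.keys u" "t \<in> Poly_Mapping.keys v" "q = r + t"
          using p(2) keys_mult[of u v] x(1) by blast
        moreover have "1 \<le> total_deg r" "n \<le> total_deg t"
          using x mem_max_ideal_iff Suc.IH calculation by blast+
        ultimately show ?thesis
          using p(3) by simp
      qed
      then show ?case
        using step.IH keys_add[of "c * x" y] by blast
    qed simp
  qed simp
next
  assume f: "\<forall>k\<in>Poly_Mapping.keys f. n \<le> total_deg k"
  have mono: "(Poly_Mapping.single k 1 :: 'a bipoly) \<in> ideal_pow max_ideal n"
    if "n \<le> total_deg k" for k
    using that
  proof (induction n arbitrary: k)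
    case (Suc n)
    obtain d e where k: "k = d + e" "total_deg d = 1"
      by (rule total_deg_split[of 1 k]) (use Suc.prems in auto)
    have "(Poly_Mapping.single d 1 :: 'a bipoly) \<in> max_ideal"
      using k(2) by (simp add: mem_max_ideal_iff)
    moreover have "(Poly_Mapping.single e 1 :: 'a bipoly) \<in> ideal_pow max_ideal n"
      using Suc k by simp
    moreover have "(Poly_Mapping.single k 1 :: 'a bipoly) =
        Poly_Mapping.single d 1 * Poly_Mapping.single e 1"
      by (simp add: mult_single k(1))
    ultimately show ?case
      unfolding ideal_pow.simps ideal_prod_def by (intro ideal.span_base) blast
  qed simp
  show "f \<in> ideal_pow max_ideal n"
    by (rule subspace_mem_if_monomials_mem[OF subspace_ideal_pow]) (use f mono in blast)
qed

text \<open>Monomials of degree exactly \<open>n\<close> suffice as test elements, since each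
  exponent of an element of \<open>ideal_pow max_ideal n\<close> lies above one of degree
  \<open>n\<close>.\<close>

lemma mem_colon_max_ideal_pow_iff:
  fixes A :: "'k::field bipoly set"
  assumes A: "A \<subseteq> monomials"
  shows "f \<in> colon (ideal_gen A) (ideal_pow max_ideal n) \<longleftrightarrow>
    (\<forall>k\<in>Poly_Mapping.keys f. \<forall>d. total_deg d = n \<longrightarrow> Poly_Mapping.single (k + d) 1 \<in> ideal_gen A)"
proof
  assume f: "f \<in> colon (ideal_gen A) (ideal_pow max_ideal n)"
  show "\<forall>k\<in>Poly_Mapping.keys f. \<forall>d. total_deg d = n \<longrightarrow>
      Poly_Mapping.single (k + d) 1 \<in> ideal_gen A"
  proof (intro ballI allI impI)
    fix k d
    assume k: "k \<in> Poly_Mapping.keys f" and d: "total_deg d = n"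
    have "Poly_Mapping.single d 1 \<in> ideal_pow (max_ideal :: 'k bipoly set) n"
      using d by (simp add: mem_max_ideal_pow_iff)
    then have "f * Poly_Mapping.single d 1 \<in> ideal_gen A"
      using f by (simp add: colon_def)
    moreover have "k + d \<in> Poly_Mapping.keys (f * Poly_Mapping.single d 1)"
      using k by (simp add: in_keys_iff lookup_mult_single_shift)
    ultimately show "Poly_Mapping.single (k + d) 1 \<in> ideal_gen A"
      using mem_ideal_gen_monomials_iff[OF A] by blast
  qed
next
  assume f: "\<forall>k\<in>Poly_Mapping.keys f. \<forall>d. total_deg d = n \<longrightarrow>
    Poly_Mapping.single (k + d) 1 \<in> ideal_gen A"
  have "f * g \<in> ideal_gen A" if g: "g \<in> ideal_pow max_ideal n" for g
    unfolding mem_ideal_gen_monomials_iff[OF A, of "f * g"]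
  proof
    fix k assume "k \<in> Poly_Mapping.keys (f * g)"
    then obtain p q where p: "p \<in> Poly_Mapping.keys f" "q \<in> Poly_Mapping.keys g" "k = p + q"
      using keys_mult[of f g] by blast
    obtain d e where d: "q = d + e" "total_deg d = n"
      using total_deg_split[of n q] g p(2) mem_max_ideal_pow_iff by blast
    have "Poly_Mapping.single (p + d) 1 \<in> ideal_gen A"
      using f p(1) d(2) by blast
    then show "Poly_Mapping.single k 1 \<in> ideal_gen A"
      unfolding monomial_in_ideal_gen_iff[OF A] p(3) d(1) by (metis add.assoc)
  qed
  then show "f \<in> colon (ideal_gen A) (ideal_pow max_ideal n)"
    by (simp add: colon_def)
qed

theorem theorem2p9:
  fixes I :: "'k::field bipoly set"
    and a b :: "nat \<Rightarrow> nat"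
    and m :: nat
  assumes "monomial_ideal I"
    and "min_gens I = {x1 ^ a i * x2 ^ b i | i. i \<in> {1..m}}"
    and "strict_antimono_on {1..m} a"
    and "strict_mono_on {1..m} b"
    and "m \<ge> 2"
  shows "int (sat I) = int (MAX i\<in>{1..m-1}. a i + b (i + 1)) - int (a m) - int (b 1) - 1"
proof -
  define G where "G = (min_gens I :: 'k bipoly set)"
  have "minimal_monomial_gens I G"
    unfolding G_def min_gens_def by (rule theI'[OF ex1_minimal_monomial_gens[OF assms(1)]])
  then have G: "G \<subseteq> monomials" "I = ideal_gen G"
    by (auto simp: minimal_monomial_gens_def)
  define U where "U = {(p, q). \<exists>i\<in>{1..m}. a i \<le> p \<and> b i \<le> q}"
  have G_eq: "Poly_Mapping.single e 1 \<in> G \<longleftrightarrow> (\<exists>i\<in>{1..m}. e = (a i, b i))" for e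
    unfolding G_def assms(2) monomial_eq_single by auto
  have U: "Poly_Mapping.single e 1 \<in> ideal_gen G \<longleftrightarrow> e \<in> U" for e
  proof -
    have "(\<exists>d. e = (p, q) + d) \<longleftrightarrow> p \<le> fst e \<and> q \<le> snd e" for p q
      by (auto simp: prod_eq_iff le_iff_add)
    then show ?thesis
      unfolding monomial_in_ideal_gen_iff[OF G(1)] G_eq U_def by (cases e) (simp, blast)
  qed
  define C where "C = (\<lambda>n. colon I (ideal_pow max_ideal n))"
  have C: "f \<in> C n \<longleftrightarrow> (\<forall>k\<in>Poly_Mapping.keys f. \<forall>d. total_deg d = n \<longrightarrow> k + d \<in> U)" for f n
    unfolding C_def G(2) mem_colon_max_ideal_pow_iff[OF G(1)] U ..
  have a_mono: "a j \<le> a i" and b_mono: "b i \<le> b j" if "1 \<le> i" "i \<le> j" "j \<le> m" for i j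
    using monotone_onD[OF assms(3), of i j] monotone_onD[OF assms(4), of i j] that
    by (cases "i = j"; simp)+
  have a_less: "a (i + 1) < a i" and b_less: "b i < b (i + 1)" if "1 \<le> i" "i \<le> m - 1" for i
    using monotone_onD[OF assms(3), of i "i + 1"] monotone_onD[OF assms(4), of i "i + 1"] that assms(5)
    by simp_all
  define s where "s = (MAX i\<in>{1..m-1}. a i + b (i + 1))"
  have s_ge: "a i + b (i + 1) \<le> s" if "1 \<le> i" "i \<le> m - 1" for i
    unfolding s_def using that by (intro Max_ge) auto
  have "s \<in> (\<lambda>i. a i + b (i + 1)) ` {1..m-1}"
    unfolding s_def using assms(5) by (intro Max_in) auto
  then obtain i0 where i0: "1 \<le> i0" "i0 \<le> m - 1" "s = a i0 + b (i0 + 1)"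
    by auto
  have i0_le: "i0 + 1 \<le> m" using i0(2) assms(5) by linarith
  \<comment> \<open>Strictness makes both coordinates of the corner below genuine, untruncated
    differences.\<close>
  then have ai0: "a m < a i0" and bi0: "b 1 < b (i0 + 1)"
    using a_less[OF i0(1,2)] b_less[OF i0(1,2)] a_mono[of "i0 + 1" m] b_mono[of 1 i0] i0(1)
    by simp_all
  \<comment> \<open>Generators up to \<open>i0\<close> have too large an \<open>x1\<close>-exponent,
    the later ones too large an \<open>x2\<close>-exponent.\<close>
  have corner: "(a i0 - 1, b (i0 + 1) - 1) \<notin> U"
  proof
    assume "(a i0 - 1, b (i0 + 1) - 1) \<in> U"
    then obtain j where j: "1 \<le> j" "j \<le> m" "a j \<le> a i0 - 1" "b j \<le> b (i0 + 1) - 1"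
      by (auto simp: U_def)
    show False
    proof (cases "j \<le> i0")
      case True
      then show ?thesis using a_mono[of j i0] j i0_le ai0 by simp
    next
      case False
      then show ?thesis using b_mono[of "i0 + 1" j] j bi0 by simp
    qed
  qed
  have large: "e \<in> U" if e: "a m \<le> fst e" "b 1 \<le> snd e" "s \<le> total_deg e + 1" for e
  proof -
    \<comment> \<open>The last generator whose \<open>x2\<close>-exponent fits. If
      \<open>i < m\<close>, then \<open>snd e + 1 \<le> b (i + 1)\<close>, and the degree bound
      forces \<open>a i \<le> fst e\<close>.\<close>
    define i where "i = Max {i \<in> {1..m}. b i \<le> snd e}"
    have "i \<in> {i \<in> {1..m}. b i \<le> snd e}"
      unfolding i_def using e(2) assms(5) by (intro Max_in) (auto intro!: exI[of _ 1])
    then have i: "1 \<le> i" "i \<le> m" "b i \<le> snd e" by auto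
    have "a i \<le> fst e"
    proof (cases "i = m")
      case False
      then have "i + 1 \<notin> {i \<in> {1..m}. b i \<le> snd e}"
        using Max_ge[of "{i \<in> {1..m}. b i \<le> snd e}" "i + 1"] unfolding i_def[symmetric] by auto
      then have "snd e < b (i + 1)" using i False by auto
      moreover have "a i + b (i + 1) \<le> s" using i False by (intro s_ge) auto
      ultimately show ?thesis using e(3) by linarith
    qed (use e in simp)
    then show ?thesis using i by (auto simp: U_def split: prod.splits)
  qed
  have U_le: "a m \<le> fst e" "b 1 \<le> snd e" if e: "e \<in> U" for e
  proof -
    obtain j where "1 \<le> j" "j \<le> m" "a j \<le> fst e" "b j \<le> snd e"
      using e by (auto simp: U_def)
    then show "a m \<le> fst e" "b 1 \<le> snd e"
      using a_mono[of j m] b_mono[of 1 j] by auto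
  qed
  have U_add: "e + d \<in> U" if "e \<in> U" for e d
    using that by (auto simp: U_def case_prod_unfold intro: trans_le_add1)
  define K where "K = s - a m - b 1 - 1"
  \<comment> \<open>Hence the natural subtraction in \<open>K\<close> does not truncate.\<close>
  have s_gt: "a m + b 1 + 2 \<le> s" using ai0 bi0 i0 by auto
  have "sat I = (LEAST k. C k = C (k + 1))"
    by (simp add: sat_def C_def)
  also have "\<dots> = K"
  proof (rule Least_equality)
    show "C K = C (K + 1)"
    proof (intro equalityI subsetI)
      fix f assume f: "f \<in> C K"
      show "f \<in> C (K + 1)"
        unfolding C
      proof (intro ballI allI impI)
        fix k d :: "nat \<times> nat" assume k: "k \<in> Poly_Mapping.keys f" "total_deg d = K + 1"
        obtain d' e where d: "d = d' + e" "total_deg d' = K"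
          by (rule total_deg_split[of K d]) (use k(2) in auto)
        have "k + d' \<in> U" using f k(1) d(2) C by blast
        then show "k + d \<in> U"
          using U_add[of "k + d'" e] by (simp add: d(1) add.assoc)
      qed
    next
      fix f assume f: "f \<in> C (K + 1)"
      show "f \<in> C K"
        unfolding C
      proof (intro ballI allI impI)
        fix k d :: "nat \<times> nat" assume k: "k \<in> Poly_Mapping.keys f" "total_deg d = K"
        have in_U: "k + d \<in> U" if "total_deg d = K + 1" for d
          using f k(1) that unfolding C by blast
        \<comment> \<open>A pure power of one variable leaves the other coordinate of
          \<open>k\<close> unchanged. Then \<open>k + d\<close> has degree at least
          \<open>a m + b 1 + K = s - 1\<close>, just what \<open>large\<close> needs.\<close>
        have "a m \<le> fst k" "b 1 \<le> snd k"
          using U_le(1)[OF in_U[of "(0, K + 1)"]] U_le(2)[OF in_U[of "(K + 1, 0)"]] by simp_all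
        then show "k + d \<in> U"
          using k(2) s_gt by (intro large) (auto simp: K_def)
      qed
    qed
  next
    fix n assume eq: "C n = C (n + 1)"
    show "K \<le> n"
    proof (rule ccontr)
      assume "\<not> K \<le> n"
      then have n: "n \<le> (a i0 - 1 - a m) + (b (i0 + 1) - 1 - b 1)"
        using ai0 bi0 i0(3) by (auto simp: K_def)
      \<comment> \<open>Descends from the corner by degree \<open>n\<close>, first in
        \<open>x1\<close> down to at most \<open>a m\<close>, then in \<open>x2\<close>; the bound
        on \<open>n\<close> keeps the second coordinate at least \<open>b 1\<close>.\<close>
      define d where "d = (min n (a i0 - 1 - a m), n - min n (a i0 - 1 - a m))"
      define v where "v = (a i0 - 1, b (i0 + 1) - 1) - d"
      have d: "total_deg d = n" "v + d = (a i0 - 1, b (i0 + 1) - 1)"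
        using n ai0 bi0 by (auto simp: d_def v_def)
      have v: "a m \<le> fst v" "b 1 \<le> snd v" "total_deg v + n + 2 = s"
        using n ai0 bi0 i0(3) by (auto simp: d_def v_def)
      \<comment> \<open>Adding degree \<open>n + 1\<close> to \<open>v\<close> reaches degree
        \<open>s - 1\<close>, whereas adding \<open>d\<close> of degree \<open>n\<close> only
        returns to the corner.\<close>
      have "(Poly_Mapping.single v 1 :: 'k bipoly) \<in> C (n + 1)"
        unfolding C using v by (auto intro!: large)
      moreover have "(Poly_Mapping.single v 1 :: 'k bipoly) \<notin> C n"
        unfolding C using d corner by (auto simp del: split_paired_All split_paired_Ex intro!: exI[of _ d])
      ultimately show False using eq by blast
    qed
  qed
  finally show ?thesis
    unfolding s_def[symmetric] K_def using s_gt by simp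
qed

end
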